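(* Let $\nu$ be a Borel probability measure on $\mathbb{R}$ supported in $[-1,1]$. For any $\alpha\in(1,2)$, there exists a distribution $\mu$ on $\mathbb{R}$ for which the following holds: for $X\sim\mu$, $$ \mathbb{E}[|X|^{4\alpha}]=\infty,\qquad \mathbb{E}[|X|^{2q}]<\infty\ \text{ for all } q\in(0,2\alpha), $$ and $$ \liminf_{n\to\infty}\,n^{\frac{\alpha-1}{\alpha}}\,\mathbb{E}\big[|D(\hat\mu_n,\hat\nu_n)-D(\mu,\nu)|\big]>0 . $$
   Context: For Borel probability measures $\mu,\nu$ on $\mathbb{R}$ with finite fourth moments, $$ D(\mu,\nu):=\mathsf{GW}_{2,2}^2(\mu,\nu)=\inf_{\pi\in\Pi(\mu,\nu)}\int\int\big||x-x'|^2-|y-y'|^2\big|^2\,d\pi(x,y)\,d\pi(x',y'), $$ where $\Pi(\mu,\nu)$ is the set of couplings of $\mu$ and $\nu$ (joint distributions on $\mathbb{R}\times\mathbb{R}$ with marginals $\mu,\nu$). $X_1,\dots,X_n$ are i.i.d. from $\mu$ and $Y_1,\dots,Y_n$ are i.i.d. from $\nu$, the two samples being independent of each other; $\hat\mu_n=\frac1n\sum_{i=1}^n\delta_{X_i}$ and $\hat\nu_n=\frac1n\sum_{j=1}^n\delta_{Y_j}$. *)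

theory Defs
  imports "HOL-Probability.Probability"
begin

definition couplings :: "real measure \<Rightarrow> real measure \<Rightarrow> (real \<times> real) measure set" where
  "couplings \<mu> \<nu> =
    {\<pi>. prob_space \<pi> \<and> sets \<pi> = sets (borel \<Otimes>\<^sub>M borel)
        \<and> distr \<pi> borel fst = \<mu> \<and> distr \<pi> borel snd = \<nu>}"

definition GW22_sq_ennreal :: "real measure \<Rightarrow> real measure \<Rightarrow> ennreal" where
  "GW22_sq_ennreal \<mu> \<nu> =
    (INF \<pi>\<in>couplings \<mu> \<nu>.
      \<integral>\<^sup>+ (x', y'). (\<integral>\<^sup>+ (x, y).
        ennreal (\<bar>\<bar>x - x'\<bar>\<^sup>2 - \<bar>y - y'\<bar>\<^sup>2\<bar>\<^sup>2) \<partial>\<pi>) \<partial>\<pi>)"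

text \<open>The infimum is finite whenever both measures are probability measures with finite
  fourth moments (use the product coupling), so the conversion to the reals loses nothing there.\<close>

definition GW22_sq :: "real measure \<Rightarrow> real measure \<Rightarrow> real" where
  "GW22_sq \<mu> \<nu> = enn2real (GW22_sq_ennreal \<mu> \<nu>)"

definition empirical_measure :: "nat \<Rightarrow> (nat \<Rightarrow> real) \<Rightarrow> real measure" where
  "empirical_measure n x =
    measure_of UNIV (sets borel)
      (\<lambda>A. (\<Sum>i\<in>{1..n}. emeasure (return borel (x i)) A) / of_nat n)"

lemma sets_empirical_measure [simp]: "sets (empirical_measure n x) = sets borel"
  unfolding empirical_measure_def
  by (metis sets.sets_measure_of_eq space_borel)

lemma emeasure_empirical_measure:
  assumes A: "A \<in> sets borel"
  shows "emeasure (empirical_measure n x) A =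
    (\<Sum>i\<in>{1..n}. emeasure (return borel (x i)) A) / of_nat n"
proof -
  let ?f = "\<lambda>A. (\<Sum>i\<in>{1..n}. emeasure (return borel (x i)) A) / (of_nat n :: ennreal)"
  have "countably_additive (sets borel) ?f"
  proof (rule countably_additiveI)
    fix B :: "nat \<Rightarrow> real set"
    assume B: "range B \<subseteq> sets borel" "disjoint_family B"
    have "(\<Sum>k. ?f (B k)) = (\<Sum>k. \<Sum>i\<in>{1..n}. emeasure (return borel (x i)) (B k)) / of_nat n"
      by (simp add: divide_ennreal_def)
    also have "(\<Sum>k. \<Sum>i\<in>{1..n}. emeasure (return borel (x i)) (B k)) =
        (\<Sum>i\<in>{1..n}. \<Sum>k. emeasure (return borel (x i)) (B k))"
      by (rule suminf_sum) auto
    also have "\<dots> = (\<Sum>i\<in>{1..n}. emeasure (return borel (x i)) (\<Union>k. B k))"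
      using B by (intro sum.cong refl suminf_emeasure) auto
    finally show "(\<Sum>k. ?f (B k)) = ?f (\<Union>k. B k)" .
  qed
  moreover have "positive (sets borel) ?f"
    by (simp add: positive_def)
  ultimately show ?thesis
    using A sets.sigma_algebra_axioms[of "borel :: real measure"]
    unfolding empirical_measure_def
    by (intro emeasure_measure_of_sigma) simp_all
qed

text \<open>Joint law of \<open>(X\<^sub>1, \<dots>, X\<^sub>n)\<close> and \<open>(Y\<^sub>1, \<dots>, Y\<^sub>n)\<close> for two mutually independent
  samples, i.i.d. from \<open>\<mu>\<close> and from \<open>\<nu>\<close> respectively; the random variables themselves
  are the coordinate projections.\<close>

definition two_sample_law ::
    "nat \<Rightarrow> real measure \<Rightarrow> real measure \<Rightarrow> ((nat \<Rightarrow> real) \<times> (nat \<Rightarrow> real)) measure" where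
  "two_sample_law n \<mu> \<nu> = (\<Pi>\<^sub>M i\<in>{1..n}. \<mu>) \<Otimes>\<^sub>M (\<Pi>\<^sub>M j\<in>{1..n}. \<nu>)"

definition expected_GW22_error :: "nat \<Rightarrow> real measure \<Rightarrow> real measure \<Rightarrow> ennreal" where
  "expected_GW22_error n \<mu> \<nu> =
    (\<integral>\<^sup>+ (x, y). ennreal \<bar>GW22_sq (empirical_measure n x) (empirical_measure n y) - GW22_sq \<mu> \<nu>\<bar>
      \<partial>two_sample_law n \<mu> \<nu>)"

end

theory Submission
  imports Defs
begin

text \<open>Take \<open>\<mu>\<close> Pareto with tail \<open>t powr (- 4\<alpha>)\<close> and put \<open>T = n powr (1 / (4\<alpha>))\<close>, so that
  \<open>n\<close> samples contain, with probabilities bounded below, no value above \<open>T / 4\<close>, or exactly one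
  and that one above \<open>T\<close>. Raising a single sample from below \<open>T / 4\<close> to above \<open>T\<close> raises the cost
  of every fixed coupling of the empirical measures, hence also \<open>D\<close>, by at least
  \<open>T^4 / (16 n)\<close>, because \<open>\<nu>\<close> lives on \<open>[-1, 1]\<close>. So \<open>D\<close> cannot be close to the same constant in
  both situations, and \<open>T^4 / n = n powr (- (\<alpha> - 1) / \<alpha>)\<close>. No limit theorem is needed.\<close>

section \<open>Couplings of empirical measures as matrices\<close>

text \<open>These are doubly stochastic matrices scaled by \<open>1 / n\<close>, indexed by
  positions in the samples and not by sample values. The set depends on \<open>n\<close> alone, so
  two different samples can be compared under the same matrix.\<close>

definition coupling_matrices :: "nat \<Rightarrow> (nat \<times> nat \<Rightarrow> real) set" where
  "coupling_matrices n = {P. (\<forall>p\<in>{1..n} \<times> {1..n}. 0 \<le> P p)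
     \<and> (\<forall>i\<in>{1..n}. (\<Sum>j\<in>{1..n}. P (i, j)) = 1 / real n)
     \<and> (\<forall>j\<in>{1..n}. (\<Sum>i\<in>{1..n}. P (i, j)) = 1 / real n)}"

text \<open>This is the double integral defining \<open>D\<close>, for the discrete coupling with
  mass \<open>P (i, j)\<close> at \<open>(x i, y j)\<close>; \<open>q\<close> plays the primed
  point. For fixed \<open>P\<close> it is a polynomial in the sample values.\<close>

definition matrix_cost ::
    "nat \<Rightarrow> (nat \<times> nat \<Rightarrow> real) \<Rightarrow> (nat \<Rightarrow> real) \<Rightarrow> (nat \<Rightarrow> real) \<Rightarrow> real" where
  "matrix_cost n P x y = (\<Sum>q\<in>{1..n} \<times> {1..n}. \<Sum>p\<in>{1..n} \<times> {1..n}.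
     P q * (P p * ((x (fst p) - x (fst q))\<^sup>2 - (y (snd p) - y (snd q))\<^sup>2)\<^sup>2))"

lemma coupling_matricesD:
  assumes "P \<in> coupling_matrices n"
  shows "\<And>p. p \<in> {1..n} \<times> {1..n} \<Longrightarrow> 0 \<le> P p"
    and "\<And>i. i \<in> {1..n} \<Longrightarrow> (\<Sum>j\<in>{1..n}. P (i, j)) = 1 / real n"
    and "\<And>j. j \<in> {1..n} \<Longrightarrow> (\<Sum>i\<in>{1..n}. P (i, j)) = 1 / real n"
  using assms by (auto simp: coupling_matrices_def)

lemma coupling_matrices_nonempty: "coupling_matrices n \<noteq> {}"
proof -
  have "(\<lambda>_. 1 / (real n * real n)) \<in> coupling_matrices n"
    by (simp add: coupling_matrices_def)
  then show ?thesis by blast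
qed

lemma sum_coupling_matrix_fst:
  assumes "P \<in> coupling_matrices n"
  shows "(\<Sum>p\<in>{1..n} \<times> {1..n}. P p * f (fst p)) = (\<Sum>i\<in>{1..n}. f i) / real n"
proof -
  have "(\<Sum>p\<in>{1..n} \<times> {1..n}. P p * f (fst p)) = (\<Sum>i\<in>{1..n}. (\<Sum>j\<in>{1..n}. P (i, j)) * f i)"
    by (simp add: sum.cartesian_product sum_distrib_right case_prod_beta)
  also have "\<dots> = (\<Sum>i\<in>{1..n}. f i / real n)"
    by (intro sum.cong refl) (simp add: coupling_matricesD(2)[OF assms, simplified])
  finally show ?thesis by (simp add: sum_divide_distrib)
qed

lemma sum_coupling_matrix_snd:
  assumes "P \<in> coupling_matrices n"
  shows "(\<Sum>p\<in>{1..n} \<times> {1..n}. P p * f (snd p)) = (\<Sum>j\<in>{1..n}. f j) / real n"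
proof -
  have "(\<Sum>p\<in>{1..n} \<times> {1..n}. P p * f (snd p)) = (\<Sum>i\<in>{1..n}. \<Sum>j\<in>{1..n}. P (i, j) * f j)"
    by (simp add: sum.cartesian_product case_prod_beta)
  also have "\<dots> = (\<Sum>j\<in>{1..n}. (\<Sum>i\<in>{1..n}. P (i, j)) * f j)"
    by (subst sum.swap) (simp add: sum_distrib_right)
  also have "\<dots> = (\<Sum>j\<in>{1..n}. f j / real n)"
    by (intro sum.cong refl) (simp add: coupling_matricesD(3)[OF assms, simplified])
  finally show ?thesis by (simp add: sum_divide_distrib)
qed

section \<open>Passage between matrices and couplings of empirical measures\<close>

lemma emeasure_empirical_measure_indicator:
  assumes "A \<in> sets borel" "n > 0"
  shows "emeasure (empirical_measure n x) A = ennreal ((\<Sum>i\<in>{1..n}. indicator A (x i)) / real n)"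
proof -
  have "(\<Sum>i\<in>{1..n}. emeasure (return borel (x i)) A) = ennreal (\<Sum>i\<in>{1..n}. indicator A (x i))"
    using assms by (simp add: ennreal_indicator flip: sum_ennreal)
  then show ?thesis
    using assms
    by (simp add: emeasure_empirical_measure divide_ennreal ennreal_of_nat_eq_real_of_nat sum_nonneg)
qed

lemma measure_empirical_measure:
  assumes "A \<in> sets borel" "n > 0"
  shows "measure (empirical_measure n x) A = (\<Sum>i\<in>{1..n}. indicator A (x i)) / real n"
  using emeasure_empirical_measure_indicator[OF assms] by (simp add: measure_def sum_nonneg)

text \<open>Push the point measure with weights \<open>P\<close> forward from index pairs to sample
  points. Coinciding sample values cause no trouble here, since their masses simply add up.\<close>

lemma coupling_of_matrix:
  assumes P: "P \<in> coupling_matrices n" and n: "n > 0"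
  obtains \<pi> where "\<pi> \<in> couplings (empirical_measure n x) (empirical_measure n y)"
    and "\<And>h. h \<in> borel_measurable (borel \<Otimes>\<^sub>M borel) \<Longrightarrow>
      (\<integral>\<^sup>+z. h z \<partial>\<pi>) = (\<Sum>p\<in>{1..n} \<times> {1..n}. ennreal (P p) * h (x (fst p), y (snd p)))"
proof -
  let ?J = "{1..n} \<times> {1..n}"
  let ?f = "\<lambda>p. (x (fst p), y (snd p))"
  let ?N = "point_measure ?J (\<lambda>p. ennreal (P p))"
  define \<pi> where "\<pi> = distr ?N (borel \<Otimes>\<^sub>M borel) ?f"
  have meas: "?f \<in> measurable ?N (borel \<Otimes>\<^sub>M borel)"
    by (simp add: point_measure_def space_pair_measure)
  have nn: "(\<integral>\<^sup>+z. h z \<partial>\<pi>) = (\<Sum>p\<in>?J. ennreal (P p) * h (?f p))"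
    if "h \<in> borel_measurable (borel \<Otimes>\<^sub>M borel)" for h
    unfolding \<pi>_def using that
    by (subst nn_integral_distr[OF meas]) (auto simp: nn_integral_point_measure_finite)
  have sets: "sets \<pi> = sets (borel \<Otimes>\<^sub>M borel)" by (simp add: \<pi>_def)
  have em: "emeasure \<pi> A = ennreal (\<Sum>p\<in>?J. P p * indicator A (?f p))"
    if A: "A \<in> sets (borel \<Otimes>\<^sub>M borel)" for A
  proof -
    have "emeasure \<pi> A = (\<integral>\<^sup>+z. indicator A z \<partial>\<pi>)"
      using A sets by simp
    also have "\<dots> = (\<Sum>p\<in>?J. ennreal (P p) * indicator A (?f p))"
      using A by (intro nn) simp
    also have "\<dots> = (\<Sum>p\<in>?J. ennreal (P p * indicator A (?f p)))"
      by (intro sum.cong refl) (simp add: ennreal_mult'' ennreal_indicator)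
    also have "\<dots> = ennreal (\<Sum>p\<in>?J. P p * indicator A (?f p))"
      by (intro sum_ennreal mult_nonneg_nonneg coupling_matricesD(1)[OF P]) auto
    finally show ?thesis .
  qed
  have space: "space \<pi> = UNIV" using sets_eq_imp_space_eq[OF sets] by (simp add: space_pair_measure)
  have "prob_space \<pi>"
  proof
    show "emeasure \<pi> (space \<pi>) = 1"
      using em[of UNIV] sum_coupling_matrix_fst[OF P, of "\<lambda>_. 1"] n
        sets.top[of \<pi>, unfolded space sets]
      by (simp add: space)
  qed
  moreover have "distr \<pi> borel fst = empirical_measure n x"
  proof (rule measure_eqI)
    fix A :: "real set" assume "A \<in> sets (distr \<pi> borel fst)"
    then have A: "A \<in> sets borel" by simp
    have "emeasure (distr \<pi> borel fst) A = emeasure \<pi> (A \<times> UNIV)"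
      using A sets by (subst emeasure_distr)
        (auto simp: space measurable_cong_sets[OF sets refl] intro!: arg_cong[where f="emeasure \<pi>"])
    also have "\<dots> = ennreal (\<Sum>p\<in>?J. P p * indicator A (x (fst p)))"
      using A by (subst em) (auto simp: indicator_def)
    finally show "emeasure (distr \<pi> borel fst) A = emeasure (empirical_measure n x) A"
      using A n sum_coupling_matrix_fst[OF P, of "\<lambda>i. indicator A (x i)"]
      by (simp add: emeasure_empirical_measure_indicator)
  qed simp
  moreover have "distr \<pi> borel snd = empirical_measure n y"
  proof (rule measure_eqI)
    fix A :: "real set" assume "A \<in> sets (distr \<pi> borel snd)"
    then have A: "A \<in> sets borel" by simp
    have "emeasure (distr \<pi> borel snd) A = emeasure \<pi> (UNIV \<times> A)"
      using A sets by (subst emeasure_distr)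
        (auto simp: space measurable_cong_sets[OF sets refl] intro!: arg_cong[where f="emeasure \<pi>"])
    also have "\<dots> = ennreal (\<Sum>p\<in>?J. P p * indicator A (y (snd p)))"
      using A by (subst em) (auto simp: indicator_def)
    finally show "emeasure (distr \<pi> borel snd) A = emeasure (empirical_measure n y) A"
      using A n sum_coupling_matrix_snd[OF P, of "\<lambda>i. indicator A (y i)"]
      by (simp add: emeasure_empirical_measure_indicator)
  qed simp
  ultimately have "\<pi> \<in> couplings (empirical_measure n x) (empirical_measure n y)"
    using sets by (simp add: couplings_def)
  then show ?thesis using nn that by blast
qed

text \<open>Group the indices by the value of \<open>g\<close>: the weight \<open>c\<close> is the
  reciprocal of the fibre size, so each fibre contributes \<open>F b\<close> once. The reciprocal is
  stated as a product equal to 1 so that the lemma covers both \<open>real\<close> (marginals) and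
  \<open>ennreal\<close> (integrals).\<close>

lemma sum_weighted_fibres:
  fixes F :: "'b \<Rightarrow> 'c::comm_semiring_1"
  assumes "finite I" and "\<And>i. i \<in> I \<Longrightarrow> of_nat (card {k \<in> I. g k = g i}) * c i = 1"
    and "\<And>i k. i \<in> I \<Longrightarrow> k \<in> I \<Longrightarrow> g i = g k \<Longrightarrow> c i = c k"
  shows "(\<Sum>i\<in>I. c i * F (g i)) = (\<Sum>b\<in>g ` I. F b)"
proof -
  have "(\<Sum>i | i \<in> I \<and> g i = g k. c i * F (g i)) = F (g k)" if k: "k \<in> I" for k
  proof -
    have "(\<Sum>i | i \<in> I \<and> g i = g k. c i * F (g i)) = (\<Sum>i | i \<in> I \<and> g i = g k. c k * F (g k))"
    proof (rule sum.cong)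
      fix i assume "i \<in> {i. i \<in> I \<and> g i = g k}"
      then show "c i * F (g i) = c k * F (g k)" using assms(3)[of i k] k by simp
    qed simp
    also have "\<dots> = (of_nat (card {i \<in> I. g i = g k}) * c k) * F (g k)"
      by (simp add: mult.assoc)
    finally show ?thesis using assms(2)[OF k] by simp
  qed
  then have "(\<Sum>i | i \<in> I \<and> g i = b. c i * F (g i)) = F b" if "b \<in> g ` I" for b
    using that by (elim imageE) simp
  then show ?thesis
    using sum.image_gen[OF assms(1), of "\<lambda>i. c i * F (g i)" g] by simp
qed

lemma AE_empirical_measure: "n > 0 \<Longrightarrow> AE a in empirical_measure n x. a \<in> x ` {1..n}"
proof (rule AE_I')
  assume "n > 0"
  then show "- (x ` {1..n}) \<in> null_sets (empirical_measure n x)"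
    by (auto simp: null_sets_def emeasure_empirical_measure_indicator borel_closed finite_imp_closed
        intro!: sum.neutral borel_comp)
qed auto

text \<open>The mass of \<open>\<pi>\<close> at a point \<open>(a, b)\<close> is spread evenly over all index pairs \<open>(i, j)\<close>
  with \<open>x\<^sub>i = a\<close> and \<open>y\<^sub>j = b\<close>; this matters because sample values may coincide.\<close>

lemma matrix_of_coupling:
  assumes \<pi>: "\<pi> \<in> couplings (empirical_measure n x) (empirical_measure n y)" and n: "n > 0"
  obtains P where "P \<in> coupling_matrices n"
    and "\<And>h. h \<in> borel_measurable (borel \<Otimes>\<^sub>M borel) \<Longrightarrow>
      (\<integral>\<^sup>+z. h z \<partial>\<pi>) = (\<Sum>p\<in>{1..n} \<times> {1..n}. ennreal (P p) * h (x (fst p), y (snd p)))"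
proof -
  let ?I = "{1..n}"
  \<comment> \<open>Reciprocal of the multiplicity of the value \<open>g i\<close> in the sample,
    used with \<open>g\<close> being \<open>x\<close> and \<open>y\<close>.\<close>
  define w where "w g i = 1 / real (card {k \<in> ?I. g k = g i})" for g :: "nat \<Rightarrow> real" and i
  define P where "P p = w x (fst p) * (w y (snd p) * measure \<pi> {(x (fst p), y (snd p))})" for p
  interpret prob_space \<pi> using \<pi> by (simp add: couplings_def)
  have sets[measurable_cong]: "sets \<pi> = sets (borel \<Otimes>\<^sub>M borel)"
    and fst: "distr \<pi> borel fst = empirical_measure n x"
    and snd: "distr \<pi> borel snd = empirical_measure n y"
    using \<pi> by (auto simp: couplings_def)
  have space: "space \<pi> = UNIV" using sets_eq_imp_space_eq[OF sets] by (simp add: space_pair_measure)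
  have sing[measurable]: "{z} \<in> sets \<pi>" for z
    unfolding sets borel_prod by (rule borel_closed[OF closed_singleton])
  have fin: "finite C \<Longrightarrow> C \<in> sets \<pi>" for C
    using sets.finite_UN[of C "\<lambda>z. {z}" \<pi>] sing by simp
  have card0: "card {k \<in> ?I. g k = g i} \<noteq> 0" if "i \<in> ?I" for g :: "nat \<Rightarrow> real" and i
    using that by (auto simp: card_eq_0_iff)
  have w0: "0 \<le> w g i" for g i by (simp add: w_def)
  have w1: "real (card {k \<in> ?I. g k = g i}) * w g i = 1" if "i \<in> ?I" for g i
    using card0[OF that] by (simp add: w_def)
  have w1': "of_nat (card {k \<in> ?I. g k = g i}) * ennreal (w g i) = 1" if "i \<in> ?I" for g i
    using w1[OF that, of g] w0
    by (simp add: ennreal_of_nat_eq_real_of_nat del: ennreal_eq_1 flip: ennreal_mult)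
  have wc: "w g i = w g k" if "g i = g k" for g i k using that by (simp add: w_def)
  have fibres: "(\<Sum>i\<in>?I. w g i * F (g i)) = (\<Sum>b\<in>g ` ?I. F b)" for g and F :: "real \<Rightarrow> real"
    by (rule sum_weighted_fibres[OF _ w1 wc]) simp_all
  have fibres': "(\<Sum>i\<in>?I. ennreal (w g i) * F (g i)) = (\<Sum>b\<in>g ` ?I. F b)"
    for g and F :: "real \<Rightarrow> ennreal"
    by (rule sum_weighted_fibres[OF _ w1' arg_cong[where f=ennreal, OF wc]]) simp_all
  \<comment> \<open>The atom at \<open>g i\<close> has mass multiplicity over \<open>n\<close>; the
    weight cancels the multiplicity. This is what makes the row and column sums of \<open>P\<close>
    equal to \<open>1 / n\<close>.\<close>
  have emp: "measure (empirical_measure n g) {g i} * w g i = 1 / real n" if "i \<in> ?I" for g i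
  proof -
    have "(\<Sum>k\<in>?I. indicator {g i} (g k)) = real (card {k \<in> ?I. g k = g i})"
      by (simp add: indicator_def sum.If_cases Int_def)
    then show ?thesis using w1[OF that, of g] n by (simp add: measure_empirical_measure)
  qed
  have AEx: "AE z in \<pi>. fst z \<in> x ` ?I"
    using AE_empirical_measure[OF n, of x] unfolding fst[symmetric] by (rule AE_distrD[rotated]) simp
  have AEy: "AE z in \<pi>. snd z \<in> y ` ?I"
    using AE_empirical_measure[OF n, of y] unfolding snd[symmetric] by (rule AE_distrD[rotated]) simp
  \<comment> \<open>Almost surely the second coordinate is a sample value, so the finitely many
    atoms on the line with first coordinate \<open>a\<close> exhaust its mass, which the first
    marginal prescribes.\<close>
  have row: "(\<Sum>b\<in>y ` ?I. measure \<pi> {(a, b)}) = measure (empirical_measure n x) {a}" for a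
  proof -
    have "(\<Sum>b\<in>y ` ?I. measure \<pi> {(a, b)}) = (\<Sum>z\<in>{a} \<times> y ` ?I. measure \<pi> {z})"
      by (simp add: sum.cartesian_product')
    also have "\<dots> = measure \<pi> ({a} \<times> y ` ?I)"
      by (rule finite_measure_eq_sum_singleton[symmetric]) auto
    also have "\<dots> = measure \<pi> (fst -` {a} \<inter> space \<pi>)"
      using AEy by (intro measure_eq_AE fin measurable_sets[of fst _ borel]) (auto simp: space)
    also have "\<dots> = measure (distr \<pi> borel fst) {a}"
      by (subst measure_distr) auto
    finally show ?thesis by (simp add: fst)
  qed
  have col: "(\<Sum>a\<in>x ` ?I. measure \<pi> {(a, b)}) = measure (empirical_measure n y) {b}" for b
  proof -
    have "(\<Sum>a\<in>x ` ?I. measure \<pi> {(a, b)}) = (\<Sum>z\<in>x ` ?I \<times> {b}. measure \<pi> {z})"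
      by (simp add: sum.cartesian_product')
    also have "\<dots> = measure \<pi> (x ` ?I \<times> {b})"
      by (rule finite_measure_eq_sum_singleton[symmetric]) auto
    also have "\<dots> = measure \<pi> (snd -` {b} \<inter> space \<pi>)"
      using AEx by (intro measure_eq_AE fin measurable_sets[of snd _ borel]) (auto simp: space)
    also have "\<dots> = measure (distr \<pi> borel snd) {b}"
      by (subst measure_distr) auto
    finally show ?thesis by (simp add: snd)
  qed
  have "P \<in> coupling_matrices n"
    unfolding coupling_matrices_def
  proof (intro CollectI conjI ballI)
    show "0 \<le> P p" for p by (simp add: P_def w0)
  next
    fix i assume i: "i \<in> ?I"
    have "(\<Sum>j\<in>?I. P (i, j)) = w x i * (\<Sum>j\<in>?I. w y j * measure \<pi> {(x i, y j)})"
      by (simp add: P_def sum_distrib_left)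
    also have "(\<Sum>j\<in>?I. w y j * measure \<pi> {(x i, y j)}) = (\<Sum>b\<in>y ` ?I. measure \<pi> {(x i, b)})"
      by (rule fibres)
    finally show "(\<Sum>j\<in>?I. P (i, j)) = 1 / real n"
      unfolding row using emp[OF i, of x] by (simp only: mult.commute)
  next
    fix j assume j: "j \<in> ?I"
    have "(\<Sum>i\<in>?I. P (i, j)) = w y j * (\<Sum>i\<in>?I. w x i * measure \<pi> {(x i, y j)})"
      by (simp add: P_def sum_distrib_left mult.left_commute)
    also have "(\<Sum>i\<in>?I. w x i * measure \<pi> {(x i, y j)}) = (\<Sum>a\<in>x ` ?I. measure \<pi> {(a, y j)})"
      by (rule fibres)
    finally show "(\<Sum>i\<in>?I. P (i, j)) = 1 / real n"
      unfolding col using emp[OF j, of y] by (simp only: mult.commute)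
  qed
  moreover have "(\<integral>\<^sup>+z. h z \<partial>\<pi>) = (\<Sum>p\<in>?I \<times> ?I. ennreal (P p) * h (x (fst p), y (snd p)))"
    if h: "h \<in> borel_measurable (borel \<Otimes>\<^sub>M borel)" for h
  proof -
    let ?K = "x ` ?I \<times> y ` ?I"
    let ?F = "\<lambda>a b. h (a, b) * emeasure \<pi> {(a, b)}"
    \<comment> \<open>Since \<pi> is carried by the finite grid \<open>?K\<close>, the integrand may
      be replaced by its values on the atoms.\<close>
    have "(\<integral>\<^sup>+z. h z \<partial>\<pi>) = (\<integral>\<^sup>+z. (\<Sum>c\<in>?K. h c * indicator {c} z) \<partial>\<pi>)"
    proof (rule nn_integral_cong_AE)
      show "AE z in \<pi>. h z = (\<Sum>c\<in>?K. h c * indicator {c} z)"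
        using AEx AEy
      proof eventually_elim
        case (elim z)
        then have "z \<in> ?K" by (cases z) auto
        then have "(\<Sum>c\<in>?K. h c * indicator {c} z) = (\<Sum>c\<in>{z}. h c * indicator {c} z)"
          by (intro sum.mono_neutral_right) (auto simp: indicator_def)
        then show ?case by simp
      qed
    qed
    also have "\<dots> = (\<Sum>c\<in>?K. h c * emeasure \<pi> {c})"
      by (subst nn_integral_sum) (auto simp: nn_integral_cmult_indicator)
    also have "\<dots> = (\<Sum>a\<in>x ` ?I. \<Sum>b\<in>y ` ?I. ?F a b)"
      by (simp add: sum.cartesian_product case_prod_beta)
    \<comment> \<open>Sums over distinct values turn back into weighted sums over indices, first in
      \<open>x\<close>, then in \<open>y\<close>.\<close>
    also have "\<dots> = (\<Sum>i\<in>?I. ennreal (w x i) * (\<Sum>b\<in>y ` ?I. ?F (x i) b))"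
      by (rule fibres'[symmetric])
    also have "\<dots> = (\<Sum>i\<in>?I. ennreal (w x i) * (\<Sum>j\<in>?I. ennreal (w y j) * ?F (x i) (y j)))"
      by (simp only: fibres'[of y "\<lambda>b. ?F (x _) b"])
    also have "\<dots> = (\<Sum>i\<in>?I. \<Sum>j\<in>?I. ennreal (P (i, j)) * h (x i, y j))"
      by (simp add: sum_distrib_left P_def ennreal_mult w0 emeasure_eq_measure ac_simps)
    finally show ?thesis by (simp add: sum.cartesian_product case_prod_beta)
  qed
  ultimately show ?thesis using that by blast
qed

section \<open>The discrepancy of empirical measures as an infimum over matrices\<close>

text \<open>The integration formula is a hypothesis, so the lemma serves both directions: a coupling
  built from a matrix and a matrix extracted from a coupling.\<close>

lemma nn_integral_matrix_cost:
  assumes P: "P \<in> coupling_matrices n"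
    and nn: "\<And>h. h \<in> borel_measurable (borel \<Otimes>\<^sub>M borel) \<Longrightarrow>
      (\<integral>\<^sup>+z. h z \<partial>\<pi>) = (\<Sum>p\<in>{1..n} \<times> {1..n}. ennreal (P p) * h (x (fst p), y (snd p)))"
  shows "(\<integral>\<^sup>+ (a', b'). (\<integral>\<^sup>+ (a, b).
      ennreal (\<bar>\<bar>a - a'\<bar>\<^sup>2 - \<bar>b - b'\<bar>\<^sup>2\<bar>\<^sup>2) \<partial>\<pi>) \<partial>\<pi>) = ennreal (matrix_cost n P x y)"
proof -
  let ?J = "{1..n} \<times> {1..n}"
  note P0 = coupling_matricesD(1)[OF P]
  have "(\<integral>\<^sup>+ (a', b'). (\<integral>\<^sup>+ (a, b). ennreal (\<bar>\<bar>a - a'\<bar>\<^sup>2 - \<bar>b - b'\<bar>\<^sup>2\<bar>\<^sup>2) \<partial>\<pi>) \<partial>\<pi>)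
    = (\<integral>\<^sup>+ q. (\<Sum>p\<in>?J. ennreal (P p) *
        ennreal (((x (fst p) - fst q)\<^sup>2 - (y (snd p) - snd q)\<^sup>2)\<^sup>2)) \<partial>\<pi>)"
    by (intro nn_integral_cong) (simp add: case_prod_beta nn)
  also have "\<dots> = (\<Sum>q\<in>?J. ennreal (P q) * (\<Sum>p\<in>?J. ennreal (P p) *
        ennreal (((x (fst p) - x (fst q))\<^sup>2 - (y (snd p) - y (snd q))\<^sup>2)\<^sup>2)))"
    by (subst nn) simp_all
  also have "\<dots> = (\<Sum>q\<in>?J. ennreal (P q * (\<Sum>p\<in>?J. P p *
        ((x (fst p) - x (fst q))\<^sup>2 - (y (snd p) - y (snd q))\<^sup>2)\<^sup>2)))"
  proof (intro sum.cong refl)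
    fix q assume q: "q \<in> ?J"
    have "(\<Sum>p\<in>?J. ennreal (P p) *
        ennreal (((x (fst p) - x (fst q))\<^sup>2 - (y (snd p) - y (snd q))\<^sup>2)\<^sup>2))
      = (\<Sum>p\<in>?J. ennreal (P p *
        ((x (fst p) - x (fst q))\<^sup>2 - (y (snd p) - y (snd q))\<^sup>2)\<^sup>2))"
      using P0 by (intro sum.cong refl) (simp add: ennreal_mult)
    also have "\<dots> = ennreal (\<Sum>p\<in>?J. P p *
        ((x (fst p) - x (fst q))\<^sup>2 - (y (snd p) - y (snd q))\<^sup>2)\<^sup>2)"
      using P0 by (intro sum_ennreal) simp
    finally show "ennreal (P q) * (\<Sum>p\<in>?J. ennreal (P p) *
        ennreal (((x (fst p) - x (fst q))\<^sup>2 - (y (snd p) - y (snd q))\<^sup>2)\<^sup>2))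
      = ennreal (P q * (\<Sum>p\<in>?J. P p *
        ((x (fst p) - x (fst q))\<^sup>2 - (y (snd p) - y (snd q))\<^sup>2)\<^sup>2))"
      using P0 q by (simp add: ennreal_mult sum_nonneg)
  qed
  also have "\<dots> = ennreal (matrix_cost n P x y)"
    unfolding matrix_cost_def sum_distrib_left[symmetric]
    using P0 by (intro sum_ennreal mult_nonneg_nonneg sum_nonneg) auto
  finally show ?thesis .
qed

text \<open>Every coupling has a matrix of the same cost and conversely. The index set of the new
  infimum is the same for all samples of size \<open>n\<close>; both measurability and the
  comparison of two samples rest on this.\<close>

lemma GW22_sq_ennreal_empirical:
  assumes "n > 0"
  shows "GW22_sq_ennreal (empirical_measure n x) (empirical_measure n y)
    = (INF P\<in>coupling_matrices n. ennreal (matrix_cost n P x y))"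
  unfolding GW22_sq_ennreal_def
proof (rule INF_eq)
  fix \<pi> assume "\<pi> \<in> couplings (empirical_measure n x) (empirical_measure n y)"
  then obtain P where P: "P \<in> coupling_matrices n"
    and "\<And>h. h \<in> borel_measurable (borel \<Otimes>\<^sub>M borel) \<Longrightarrow>
      (\<integral>\<^sup>+z. h z \<partial>\<pi>) = (\<Sum>p\<in>{1..n} \<times> {1..n}. ennreal (P p) * h (x (fst p), y (snd p)))"
    using matrix_of_coupling[OF _ assms] by blast
  from P nn_integral_matrix_cost[OF this]
  show "\<exists>P\<in>coupling_matrices n. ennreal (matrix_cost n P x y) \<le>
    (\<integral>\<^sup>+ (x', y'). (\<integral>\<^sup>+ (x, y). ennreal (\<bar>\<bar>x - x'\<bar>\<^sup>2 - \<bar>y - y'\<bar>\<^sup>2\<bar>\<^sup>2) \<partial>\<pi>) \<partial>\<pi>)"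
    by (intro bexI[of _ P]) simp_all
next
  fix P assume P: "P \<in> coupling_matrices n"
  obtain \<pi> where \<pi>: "\<pi> \<in> couplings (empirical_measure n x) (empirical_measure n y)"
    and "\<And>h. h \<in> borel_measurable (borel \<Otimes>\<^sub>M borel) \<Longrightarrow>
      (\<integral>\<^sup>+z. h z \<partial>\<pi>) = (\<Sum>p\<in>{1..n} \<times> {1..n}. ennreal (P p) * h (x (fst p), y (snd p)))"
    using coupling_of_matrix[OF P assms] by blast
  from \<pi> nn_integral_matrix_cost[OF P this(2)]
  show "\<exists>\<pi>\<in>couplings (empirical_measure n x) (empirical_measure n y).
    (\<integral>\<^sup>+ (x', y'). (\<integral>\<^sup>+ (x, y). ennreal (\<bar>\<bar>x - x'\<bar>\<^sup>2 - \<bar>y - y'\<bar>\<^sup>2\<bar>\<^sup>2) \<partial>\<pi>) \<partial>\<pi>)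
      \<le> ennreal (matrix_cost n P x y)"
    by (intro bexI[of _ \<pi>]) simp_all
qed

text \<open>Finiteness matters because \<open>enn2real\<close> sends infinity to 0, so inequalities
  pass to the reals only below infinity.\<close>

lemma GW22_sq_ennreal_empirical_finite:
  assumes "n > 0"
  shows "GW22_sq_ennreal (empirical_measure n x) (empirical_measure n y) < \<infinity>"
proof -
  obtain P where "P \<in> coupling_matrices n" using coupling_matrices_nonempty by blast
  then have "(INF P\<in>coupling_matrices n. ennreal (matrix_cost n P x y)) \<le> ennreal (matrix_cost n P x y)"
    by (rule INF_lower)
  then show ?thesis
    using GW22_sq_ennreal_empirical[OF assms, of x y] by (simp add: order_le_less_trans)
qed

text \<open>An infimum of polynomials is upper semicontinuous, hence Borel.\<close>

lemma borel_measurable_GW22_sq_empirical: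
  assumes n: "n > 0" and \<mu>: "sets \<mu> = sets borel" and \<nu>: "sets \<nu> = sets borel"
  shows "(\<lambda>z. GW22_sq (empirical_measure n (fst z)) (empirical_measure n (snd z)))
    \<in> borel_measurable (two_sample_law n \<mu> \<nu>)"
proof -
  let ?G = "\<lambda>z. INF P\<in>coupling_matrices n. ennreal (matrix_cost n P (fst z) (snd z))"
  have "?G \<in> borel_measurable borel"
  proof (rule borel_measurableI_less)
    fix a :: ennreal
    have coord: "continuous_on S (\<lambda>z. fst z i)" "continuous_on S (\<lambda>z. snd z i)"
      for i and S :: "((nat \<Rightarrow> real) \<times> (nat \<Rightarrow> real)) set"
      by (rule continuous_on_product_then_coordinatewise, intro continuous_intros)+
    have cont: "continuous_on UNIV (\<lambda>z. ennreal (matrix_cost n P (fst z) (snd z)))" for P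
      unfolding matrix_cost_def
      by (intro continuous_on_ennreal continuous_on_sum continuous_on_mult continuous_on_power
          continuous_on_diff continuous_on_const coord)
    \<comment> \<open>The union is uncountable, but each member is open, so the union is still
      Borel.\<close>
    have "{z. ?G z < a} = (\<Union>P\<in>coupling_matrices n. {z. ennreal (matrix_cost n P (fst z) (snd z)) < a})"
      by (auto simp: INF_less_iff)
    moreover have "open \<dots>"
      using cont by (intro open_UN ballI open_Collect_less continuous_on_const) auto
    ultimately show "{z \<in> space borel. ?G z < a} \<in> sets borel" by (simp add: borel_open)
  qed
  \<comment> \<open>The set above is open in the product topology on all of
    \<open>nat \<Rightarrow> real\<close>, whereas samples live on \<open>{1..n}\<close>.
    Coordinates outside \<open>{1..n}\<close> are constantly \<open>undefined\<close> there, so the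
    inclusion is measurable.\<close>
  moreover have id: "(\<lambda>x. x) \<in> measurable (\<Pi>\<^sub>M i\<in>{1..n}. M) borel"
    if "sets M = sets borel" for M :: "real measure"
  proof -
    have "(\<lambda>x i. x i) \<in> measurable (\<Pi>\<^sub>M i\<in>{1..n}. M) (\<Pi>\<^sub>M i\<in>UNIV. borel)"
    proof (rule measurable_PiM_single')
      fix i :: nat
      show "(\<lambda>x. x i) \<in> borel_measurable (\<Pi>\<^sub>M i\<in>{1..n}. M)"
      proof (cases "i \<in> {1..n}")
        case True
        then show ?thesis
          using measurable_component_singleton[of i "{1..n}" "\<lambda>_. M"] measurable_cong_sets[OF refl that]
          by blast
      next
        case False
        then have "(\<lambda>x. x i) \<in> borel_measurable (\<Pi>\<^sub>M i\<in>{1..n}. M)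
          \<longleftrightarrow> (\<lambda>x. undefined :: real) \<in> borel_measurable (\<Pi>\<^sub>M i\<in>{1..n}. M)"
          by (intro measurable_cong) (auto simp: space_PiM PiE_def extensional_def)
        then show ?thesis by simp
      qed
    qed auto
    then show ?thesis
      by (simp add: measurable_cong_sets[OF refl sets_PiM_equal_borel])
  qed
  moreover have "(\<lambda>z. z) \<in> measurable (two_sample_law n \<mu> \<nu>) borel"
  proof -
    have "(\<lambda>z. (fst z, snd z)) \<in> measurable (two_sample_law n \<mu> \<nu>) (borel \<Otimes>\<^sub>M borel)"
      unfolding two_sample_law_def
      by (intro measurable_Pair measurable_compose[OF measurable_fst id[OF \<mu>]]
          measurable_compose[OF measurable_snd id[OF \<nu>]])
    then show ?thesis by (simp add: borel_prod)
  qed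
  ultimately have "?G \<in> borel_measurable (two_sample_law n \<mu> \<nu>)"
    using measurable_compose by blast
  then show ?thesis
    unfolding GW22_sq_def GW22_sq_ennreal_empirical[OF n] by measurable
qed

section \<open>Effect of a single large observation\<close>

text \<open>Fix \<open>P\<close>. Replacing \<open>u\<close> by \<open>v\<close> changes only terms
  in which exactly one of the two indices is \<open>m\<close>, and it lowers none of them. Those
  with \<open>fst p = m\<close> and \<open>fst q \<noteq> m\<close> each gain \<open>T^4 / 8\<close>
  and have total mass \<open>(1 / n) * (1 - 1 / n)\<close>, at least \<open>1 / (2 * n)\<close>. The
  gain is uniform in \<open>P\<close>, so it passes to the infimum.\<close>

lemma GW22_sq_empirical_gap:
  fixes T u v :: real
  assumes n: "n \<ge> 2" and m: "m \<in> {1..n}" and T: "T \<ge> 8"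
    and x: "\<And>i. i \<in> {1..n} \<Longrightarrow> i \<noteq> m \<Longrightarrow> x i \<in> {1..T/4}"
    and u: "u \<in> {1..T/4}" and v: "T \<le> v"
    and y: "\<And>j. j \<in> {1..n} \<Longrightarrow> y j \<in> {-1..1}"
  shows "GW22_sq (empirical_measure n (x(m := u))) (empirical_measure n y) + T^4 / (16 * real n)
    \<le> GW22_sq (empirical_measure n (x(m := v))) (empirical_measure n y)"
proof -
  let ?J = "{1..n} \<times> {1..n}" and ?\<Delta> = "T^4 / (16 * real n)"
  define c where "c t p q = (((x(m := t)) (fst p) - (x(m := t)) (fst q))\<^sup>2 - (y (snd p) - y (snd q))\<^sup>2)\<^sup>2"
    for t and p q :: "nat \<times> nat"
  \<comment> \<open>Here \<open>s\<close> stands for a squared distance in \<open>y\<close>, and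
    \<open>T \<ge> 8\<close> makes 4 at most \<open>T^2 / 16\<close>. The difference inside the
    square is at most \<open>T^2 / 16\<close> in absolute value for \<open>u\<close>, and at least
    \<open>9/16 * T^2 - T^2 / 16 = T^2 / 2\<close> for \<open>v\<close>; finally
    \<open>1/4 - 1/256 \<ge> 1/8\<close>.\<close>
  have key: "((u - a)\<^sup>2 - s)\<^sup>2 + T^4 / 8 \<le> ((v - a)\<^sup>2 - s)\<^sup>2"
    if a: "a \<in> {1..T/4}" and s: "0 \<le> s" "s \<le> 4" for a s
  proof -
    have T2: "64 \<le> T\<^sup>2" using power_mono[of 8 T 2] T by simp
    have bd: "\<bar>z - s\<bar> \<le> T\<^sup>2 / 16" if "0 \<le> z" "z \<le> T\<^sup>2 / 16" for z
      using that s T2 by (intro abs_leI) auto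
    have "(3/4 * T)\<^sup>2 \<le> (v - a)\<^sup>2" using a v T by (intro power_mono) auto
    then have "T\<^sup>2 / 2 \<le> (v - a)\<^sup>2 - s" using s T2 by (simp add: power_mult_distrib power2_eq_square)
    then have "(T\<^sup>2 / 2)\<^sup>2 \<le> ((v - a)\<^sup>2 - s)\<^sup>2" by (intro power_mono) auto
    moreover have "(u - a)\<^sup>2 \<le> (T / 4)\<^sup>2" using a u by (intro power2_le_iff_abs_le[THEN iffD2] abs_leI) auto
    then have "\<bar>(u - a)\<^sup>2 - s\<bar> \<le> T\<^sup>2 / 16"
      using bd[of "(u - a)\<^sup>2"] by (simp add: power_divide)
    then have "((u - a)\<^sup>2 - s)\<^sup>2 \<le> (T\<^sup>2 / 16)\<^sup>2" by (intro power2_le_iff_abs_le[THEN iffD2]) auto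
    moreover have "(T\<^sup>2 / 2)\<^sup>2 = T^4 / 4" "(T\<^sup>2 / 16)\<^sup>2 = T^4 / 256"
      by (simp_all add: power_divide flip: power_mult)
    moreover have "0 \<le> T^4" by simp
    ultimately show ?thesis by linarith
  qed
  have c: "c u p q + T^4 / 8 * (of_bool (fst p = m) * of_bool (fst q \<noteq> m)) \<le> c v p q"
    if pq: "p \<in> ?J" "q \<in> ?J" for p q
  proof -
    define s where "s = (y (snd p) - y (snd q))\<^sup>2"
    have "\<bar>y (snd p) - y (snd q)\<bar> \<le> 2" using y[of "snd p"] y[of "snd q"] pq by auto
    then have "s \<le> 2\<^sup>2" unfolding s_def by (intro power2_le_iff_abs_le[THEN iffD2]) auto
    then have s: "0 \<le> s" "s \<le> 4" by (auto simp: s_def)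
    have T0: "0 \<le> T^4 / 8" by simp
    consider "fst p = m" "fst q = m" | "fst p = m" "fst q \<noteq> m" | "fst p \<noteq> m" "fst q = m"
      | "fst p \<noteq> m" "fst q \<noteq> m" by blast
    then show ?thesis
    proof cases
      case 2
      then show ?thesis using key[OF x s, of "fst q"] pq by (auto simp: c_def s_def)
    next
      \<comment> \<open>By symmetry the same gain is available here, but only its sign is
        kept.\<close>
      case 3
      then have "((u - x (fst p))\<^sup>2 - s)\<^sup>2 \<le> ((v - x (fst p))\<^sup>2 - s)\<^sup>2"
        using order_trans[OF _ key[OF x s, of "fst p"]] T0 pq by force
      with 3 show ?thesis
        by (auto simp: c_def s_def power2_commute[of "x (fst p)"])
    qed (auto simp: c_def)
  qed
  have gap: "matrix_cost n P (x(m := u)) y + ?\<Delta> \<le> matrix_cost n P (x(m := v)) y"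
    if P: "P \<in> coupling_matrices n" for P
  proof -
    note P0 = coupling_matricesD(1)[OF P]
    have row: "(\<Sum>p\<in>?J. P p * of_bool (fst p = m)) = 1 / real n"
      using sum_coupling_matrix_fst[OF P, of "\<lambda>i. of_bool (i = m)"] m
      by (simp add: of_bool_def)
    have row': "(\<Sum>q\<in>?J. P q * of_bool (fst q \<noteq> m)) = 1 - 1 / real n"
    proof -
      have "(\<Sum>q\<in>?J. P q * of_bool (fst q \<noteq> m)) = (\<Sum>q\<in>?J. P q * 1 - P q * of_bool (fst q = m))"
        by (intro sum.cong) auto
      also have "\<dots> = (\<Sum>q\<in>?J. P q * 1) - 1 / real n"
        by (simp only: sum_subtractf row)
      also have "(\<Sum>q\<in>?J. P q * 1) = 1"
        using sum_coupling_matrix_fst[OF P, of "\<lambda>_. 1"] n by simp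
      finally show ?thesis .
    qed
    \<comment> \<open>From \<open>n \<ge> 2\<close>, the factor \<open>1 - 1 / n\<close> is at least
      \<open>1/2\<close>.\<close>
    have "?\<Delta> \<le> T^4 / 8 * ((1 / real n) * (1 - 1 / real n))"
    proof -
      have "T^4 / (8 * real n) * (1/2) \<le> T^4 / (8 * real n) * (1 - 1 / real n)"
        using n by (intro mult_left_mono) (auto simp: field_simps)
      then show ?thesis by simp
    qed
    also have "(1 / real n) * (1 - 1 / real n)
        = (\<Sum>q\<in>?J. \<Sum>p\<in>?J. (P p * of_bool (fst p = m)) * (P q * of_bool (fst q \<noteq> m)))"
      by (simp only: row row' flip: sum_distrib_right sum_distrib_left)
    finally have "matrix_cost n P (x(m := u)) y + ?\<Delta> \<le> (\<Sum>q\<in>?J. \<Sum>p\<in>?J. P q * (P p * c u p q))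
        + T^4 / 8 * (\<Sum>q\<in>?J. \<Sum>p\<in>?J. (P p * of_bool (fst p = m)) * (P q * of_bool (fst q \<noteq> m)))"
      by (simp add: matrix_cost_def c_def)
    also have "\<dots> = (\<Sum>q\<in>?J. \<Sum>p\<in>?J. P q * (P p *
        (c u p q + T^4 / 8 * (of_bool (fst p = m) * of_bool (fst q \<noteq> m)))))"
      by (simp add: sum_distrib_left sum.distrib[symmetric] algebra_simps)
    also have "\<dots> \<le> (\<Sum>q\<in>?J. \<Sum>p\<in>?J. P q * (P p * c v p q))"
      using P0 c by (intro sum_mono mult_left_mono) auto
    also have "\<dots> = matrix_cost n P (x(m := v)) y"
      by (simp add: matrix_cost_def c_def)
    finally show ?thesis .
  qed
  define D where "D t = GW22_sq_ennreal (empirical_measure n (x(m := t))) (empirical_measure n y)" for t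
  have n0: "n > 0" using n by simp
  have D: "D t = (INF P\<in>coupling_matrices n. ennreal (matrix_cost n P (x(m := t)) y))" for t
    unfolding D_def by (rule GW22_sq_ennreal_empirical[OF n0])
  have fin: "D t < \<infinity>" for t
    unfolding D_def by (rule GW22_sq_ennreal_empirical_finite[OF n0])
  have cost0: "0 \<le> matrix_cost n P x' y" if "P \<in> coupling_matrices n" for P x'
    unfolding matrix_cost_def using coupling_matricesD(1)[OF that]
    by (intro sum_nonneg mult_nonneg_nonneg) auto
  \<comment> \<open>Any matrix competing for \<open>v\<close> also competes for \<open>u\<close>, at
    a cost lower by the gap.\<close>
  have "D u + ennreal ?\<Delta> \<le> D v"
    unfolding D[of v]
  proof (rule INF_greatest)
    fix P assume P: "P \<in> coupling_matrices n"
    have "D u + ennreal ?\<Delta> \<le> ennreal (matrix_cost n P (x(m := u)) y) + ennreal ?\<Delta>"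
      unfolding D using P by (intro add_right_mono INF_lower)
    also have "\<dots> \<le> ennreal (matrix_cost n P (x(m := v)) y)"
      using gap[OF P] cost0[OF P] by (simp add: ennreal_leI flip: ennreal_plus)
    finally show "D u + ennreal ?\<Delta> \<le> ennreal (matrix_cost n P (x(m := v)) y)" .
  qed
  then have "enn2real (D u + ennreal ?\<Delta>) \<le> enn2real (D v)"
    using fin by (intro enn2real_mono) auto
  then show ?thesis
    using fin[of u] by (simp add: enn2real_plus GW22_sq_def D_def)
qed

section \<open>A one-jump lower bound for product measures\<close>

text \<open>Integrate the hypothesis over independent \<open>u\<close> in \<open>S\<close> and
  \<open>v\<close> in \<open>B\<close>; each summand on the right depends on one variable only, so
  the other integrates to a mass.\<close>

lemma nn_integral_one_jump_pair:
  fixes g :: "'a \<Rightarrow> ennreal"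
  assumes "prob_space \<mu>" and S: "S \<in> sets \<mu>" and B: "B \<in> sets \<mu>" and g: "g \<in> borel_measurable \<mu>"
    and \<Delta>: "\<And>u v. u \<in> S \<Longrightarrow> v \<in> B \<Longrightarrow> \<Delta> \<le> g u + g v"
  shows "\<Delta> * (emeasure \<mu> S * emeasure \<mu> B) \<le>
    emeasure \<mu> B * (\<integral>\<^sup>+u. g u * indicator S u \<partial>\<mu>) + emeasure \<mu> S * (\<integral>\<^sup>+v. g v * indicator B v \<partial>\<mu>)"
proof -
  note [measurable] = S B g
  have "\<Delta> * (emeasure \<mu> S * emeasure \<mu> B)
      = (\<integral>\<^sup>+u. \<integral>\<^sup>+v. \<Delta> * indicator S u * indicator B v \<partial>\<mu> \<partial>\<mu>)"
    by (simp add: nn_integral_cmult nn_integral_multc mult.assoc)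
  also have "\<dots> \<le> (\<integral>\<^sup>+u. \<integral>\<^sup>+v. g u * indicator S u * indicator B v
      + indicator S u * (g v * indicator B v) \<partial>\<mu> \<partial>\<mu>)"
    using \<Delta> by (intro nn_integral_mono) (auto simp: indicator_def)
  also have "\<dots> = (\<integral>\<^sup>+u. g u * indicator S u * emeasure \<mu> B
      + indicator S u * (\<integral>\<^sup>+v. g v * indicator B v \<partial>\<mu>) \<partial>\<mu>)"
    by (simp add: nn_integral_cmult nn_integral_add)
  also have "\<dots> = (\<integral>\<^sup>+u. g u * indicator S u \<partial>\<mu>) * emeasure \<mu> B
      + emeasure \<mu> S * (\<integral>\<^sup>+v. g v * indicator B v \<partial>\<mu>)"
    by (simp add: nn_integral_add nn_integral_multc)
  finally show ?thesis by (simp add: mult.commute)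
qed

text \<open>The proof only uses the disjoint events that all coordinates lie in \<open>S\<close>, and that
  exactly one of them lies in \<open>B\<close> and all others in \<open>S\<close>.\<close>

lemma nn_integral_PiM_one_jump:
  fixes g :: "('i \<Rightarrow> 'a) \<Rightarrow> ennreal"
  assumes prob: "prob_space \<mu>" and I: "finite I"
    and S: "S \<in> sets \<mu>" and B: "B \<in> sets \<mu>" and disj: "S \<inter> B = {}"
    and g: "g \<in> borel_measurable (\<Pi>\<^sub>M i\<in>I. \<mu>)"
    and mass: "of_nat (card I) * emeasure \<mu> B \<le> 1"
    and \<Delta>: "\<And>i x u v. i \<in> I \<Longrightarrow> x \<in> (\<Pi>\<^sub>E j\<in>I - {i}. S) \<Longrightarrow> u \<in> S \<Longrightarrow> v \<in> B \<Longrightarrow>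
      \<Delta> \<le> g (x(i := u)) + g (x(i := v))"
  shows "\<Delta> * (of_nat (card I) * emeasure \<mu> B) * emeasure \<mu> S ^ card I \<le> (\<integral>\<^sup>+x. g x \<partial>(\<Pi>\<^sub>M i\<in>I. \<mu>))"
proof -
  interpret \<mu>: prob_space \<mu> by (rule prob)
  interpret product_sigma_finite "\<lambda>_. \<mu>" by unfold_locales
  note [measurable] = S B g
  let ?M = "\<Pi>\<^sub>M i\<in>I. \<mu>"
  let ?b = "emeasure \<mu> B" and ?s = "emeasure \<mu> S"
  \<comment> \<open>\<open>Z\<close> is the event without a jump, and \<open>A i\<close> the event
    whose only jump is at \<open>i\<close>.\<close>
  define Z where "Z = (\<Pi>\<^sub>E j\<in>I. S)"
  define A where "A i = (\<Pi>\<^sub>E j\<in>I. if j = i then B else S)" for i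
  have [measurable]: "Z \<in> sets ?M" "A i \<in> sets ?M" for i
    unfolding Z_def A_def using I by (auto intro!: sets_PiM_I_finite)
  \<comment> \<open>Split off coordinate \<open>i\<close>, keep all others in \<open>S\<close>, and
    apply the pair inequality to coordinate \<open>i\<close> alone.\<close>
  have step: "\<Delta> * (?s * ?b) * ?s ^ (card I - 1) \<le>
      ?b * (\<integral>\<^sup>+x. g x * indicator Z x \<partial>?M) + (\<integral>\<^sup>+x. g x * indicator (A i) x \<partial>?M)"
    if i: "i \<in> I" for i
  proof -
    let ?J = "I - {i}"
    let ?N = "\<Pi>\<^sub>M j\<in>?J. \<mu>"
    define R where "R = (\<Pi>\<^sub>E j\<in>?J. S)"
    have [measurable]: "R \<in> sets ?N" unfolding R_def using I by (auto intro!: sets_PiM_I_finite)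
    have I_eq: "insert i ?J = I" using i by blast
    have fold: "(\<integral>\<^sup>+x. f x \<partial>?M) = (\<integral>\<^sup>+x. \<integral>\<^sup>+t. f (x(i := t)) \<partial>\<mu> \<partial>?N)"
      if "f \<in> borel_measurable ?M" for f
      using product_nn_integral_insert[of ?J i f, unfolded I_eq] that I by simp
    have upd: "(\<lambda>(x, t). x(i := t)) \<in> measurable (?N \<Otimes>\<^sub>M \<mu>) ?M"
      using measurable_add_dim[of i ?J "\<lambda>_. \<mu>"] unfolding I_eq .
    have [measurable]: "(\<lambda>(x, t). g (x(i := t))) \<in> borel_measurable (?N \<Otimes>\<^sub>M \<mu>)"
      using measurable_compose[OF upd g] by (simp add: case_prod_beta)
    have Zi: "indicator Z (x(i := t)) = (indicator R x * indicator S t :: ennreal)"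
      and Ai: "indicator (A i) (x(i := t)) = (indicator R x * indicator B t :: ennreal)"
      if "x \<in> space ?N" for x t
      using that i
      by (auto simp: Z_def A_def R_def indicator_def space_PiM PiE_iff extensional_def split: if_splits)
    have ZI: "(\<integral>\<^sup>+x. g x * indicator Z x \<partial>?M)
        = (\<integral>\<^sup>+x. indicator R x * (\<integral>\<^sup>+t. g (x(i := t)) * indicator S t \<partial>\<mu>) \<partial>?N)"
      by (subst fold) (auto intro!: nn_integral_cong simp: Zi nn_integral_cmult[symmetric] ac_simps)
    have AI: "(\<integral>\<^sup>+x. g x * indicator (A i) x \<partial>?M)
        = (\<integral>\<^sup>+x. indicator R x * (\<integral>\<^sup>+t. g (x(i := t)) * indicator B t \<partial>\<mu>) \<partial>?N)"
      by (subst fold) (auto intro!: nn_integral_cong simp: Ai nn_integral_cmult[symmetric] ac_simps)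
    have "emeasure ?N R = ?s ^ (card I - 1)"
      unfolding R_def using I i by (subst emeasure_PiM) (auto simp: card_Diff_singleton)
    then have "\<Delta> * (?s * ?b) * ?s ^ (card I - 1) = (\<integral>\<^sup>+x. \<Delta> * (?s * ?b) * indicator R x \<partial>?N)"
      by (simp add: nn_integral_cmult)
    also have "\<dots> \<le> (\<integral>\<^sup>+x. ?b * (indicator R x * (\<integral>\<^sup>+t. g (x(i := t)) * indicator S t \<partial>\<mu>))
        + indicator R x * (\<integral>\<^sup>+t. g (x(i := t)) * indicator B t \<partial>\<mu>) \<partial>?N)"
    proof (rule nn_integral_mono)
      fix x assume x: "x \<in> space ?N"
      have gx: "(\<lambda>t. g (x(i := t))) \<in> borel_measurable \<mu>" using x by measurable
      show "\<Delta> * (?s * ?b) * indicator R x \<le>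
        ?b * (indicator R x * (\<integral>\<^sup>+t. g (x(i := t)) * indicator S t \<partial>\<mu>))
        + indicator R x * (\<integral>\<^sup>+t. g (x(i := t)) * indicator B t \<partial>\<mu>)"
      proof (cases "x \<in> R")
        case True
        have "\<Delta> * (?s * ?b) \<le> ?b * (\<integral>\<^sup>+t. g (x(i := t)) * indicator S t \<partial>\<mu>)
            + ?s * (\<integral>\<^sup>+t. g (x(i := t)) * indicator B t \<partial>\<mu>)"
          using \<Delta>[OF i] True by (intro nn_integral_one_jump_pair[OF prob S B gx]) (auto simp: R_def)
        \<comment> \<open>The mass of \<open>S\<close> in front of the jump term is bounded by
          1.\<close>
        also have "\<dots> \<le> ?b * (\<integral>\<^sup>+t. g (x(i := t)) * indicator S t \<partial>\<mu>)
            + 1 * (\<integral>\<^sup>+t. g (x(i := t)) * indicator B t \<partial>\<mu>)"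
          using \<mu>.emeasure_le_1 by (intro add_left_mono mult_right_mono) auto
        finally show ?thesis using True by simp
      qed simp
    qed
    also have "\<dots> = ?b * (\<integral>\<^sup>+x. g x * indicator Z x \<partial>?M) + (\<integral>\<^sup>+x. g x * indicator (A i) x \<partial>?M)"
      unfolding ZI AI by (simp add: nn_integral_add nn_integral_cmult)
    finally show ?thesis .
  qed
  have "\<Delta> * (of_nat (card I) * ?b) * ?s ^ card I = (\<Sum>i\<in>I. \<Delta> * (?s * ?b) * ?s ^ (card I - 1))"
    by (cases "card I") (simp_all add: ac_simps)
  also have "\<dots> \<le> (\<Sum>i\<in>I. ?b * (\<integral>\<^sup>+x. g x * indicator Z x \<partial>?M) + (\<integral>\<^sup>+x. g x * indicator (A i) x \<partial>?M))"
    by (intro sum_mono step)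
  also have "\<dots> = of_nat (card I) * ?b * (\<integral>\<^sup>+x. g x * indicator Z x \<partial>?M)
      + (\<Sum>i\<in>I. \<integral>\<^sup>+x. g x * indicator (A i) x \<partial>?M)"
    by (simp add: sum.distrib mult.assoc)
  \<comment> \<open>Each position \<open>i\<close> reuses \<open>Z\<close> with weight
    \<open>?b\<close>. The bound \<open>mass\<close> makes these weights add up to at most 1, so
    \<open>Z\<close> is counted at most once.\<close>
  also have "\<dots> \<le> 1 * (\<integral>\<^sup>+x. g x * indicator Z x \<partial>?M) + (\<Sum>i\<in>I. \<integral>\<^sup>+x. g x * indicator (A i) x \<partial>?M)"
    using mass by (intro add_right_mono mult_right_mono) auto
  also have "\<dots> = (\<integral>\<^sup>+x. g x * (indicator Z x + (\<Sum>i\<in>I. indicator (A i) x)) \<partial>?M)"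
    by (simp add: nn_integral_add nn_integral_sum distrib_left sum_distrib_left)
  also have "\<dots> \<le> (\<integral>\<^sup>+x. g x * 1 \<partial>?M)"
  proof (intro nn_integral_mono mult_left_mono)
    fix x
    \<comment> \<open>The position of the jump can be read off from \<open>x\<close> because
      \<open>S\<close> and \<open>B\<close> are disjoint, so all these events are pairwise
      disjoint.\<close>
    have ZA: "x \<notin> A i" if "x \<in> Z" "i \<in> I" for i
    proof
      assume "x \<in> A i"
      then have "x i \<in> B" using that(2) by (force simp: A_def PiE_iff)
      moreover have "x i \<in> S" using that by (auto simp: Z_def PiE_iff)
      ultimately show False using disj by blast
    qed
    have AA: "i = k" if "x \<in> A i" "x \<in> A k" "i \<in> I" "k \<in> I" for i k
    proof (rule ccontr)
      assume "i \<noteq> k"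
      have "x i \<in> B" using that by (force simp: A_def PiE_iff)
      moreover have "x i \<in> S" using that \<open>i \<noteq> k\<close> by (force simp: A_def PiE_iff)
      ultimately show False using disj by blast
    qed
    show "indicator Z x + (\<Sum>i\<in>I. indicator (A i) x) \<le> (1::ennreal)"
    proof (cases "\<exists>i\<in>I. x \<in> A i")
      case True
      then obtain i where i: "i \<in> I" "x \<in> A i" by blast
      have "(\<Sum>k\<in>I. indicator (A k) x) = (\<Sum>k\<in>{i}. indicator (A k) x :: ennreal)"
        using i AA I by (intro sum.mono_neutral_right) (auto simp: indicator_def)
      then show ?thesis using i ZA by (auto simp: indicator_def)
    next
      case False
      then have "(\<Sum>i\<in>I. indicator (A i) x) = (0::ennreal)" by (intro sum.neutral) auto
      then show ?thesis by (simp add: indicator_def)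
    qed
  qed simp
  finally show ?thesis by simp
qed

section \<open>Pareto distributions\<close>

definition pareto :: "real \<Rightarrow> real measure" where
  "pareto p = density lborel (\<lambda>x. ennreal (p * x powr (- p - 1)) * indicator {1..} x)"

lemma sets_pareto [simp, measurable_cong]: "sets (pareto p) = sets borel"
  by (simp add: pareto_def)

lemma space_pareto [simp]: "space (pareto p) = UNIV"
  by (simp add: pareto_def)

lemma nn_integral_pareto:
  assumes "f \<in> borel_measurable borel"
  shows "(\<integral>\<^sup>+x. f x \<partial>pareto p) = (\<integral>\<^sup>+x. ennreal (p * x powr (- p - 1)) * indicator {1..} x * f x \<partial>lborel)"
  unfolding pareto_def using assms by (subst nn_integral_density) simp_all

text \<open>The antiderivative \<open>- (x powr - r)\<close> vanishes at infinity. The lemma is used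
  with exponent \<open>p\<close> for tails and with \<open>p - r\<close> for moments.\<close>

lemma nn_integral_powr_atLeast:
  assumes "1 \<le> a" "0 < r"
  shows "(\<integral>\<^sup>+x. ennreal (r * x powr (- r - 1)) * indicator {a..} x \<partial>lborel) = ennreal (a powr - r)"
proof -
  have "((\<lambda>x. - (x powr - r)) has_real_derivative r * x powr (- r - 1)) (at x)" if "a \<le> x" for x
    using that assms by (auto intro!: derivative_eq_intros)
  moreover have "((\<lambda>x. - (x powr - r)) \<longlongrightarrow> - 0) at_top"
    using assms by (intro tendsto_minus tendsto_neg_powr filterlim_ident) auto
  ultimately have "(\<integral>\<^sup>+x. ennreal (r * x powr (- r - 1)) * indicator {a..} x \<partial>lborel)
      = ennreal (- 0 - - (a powr - r))"
    using assms by (intro nn_integral_FTC_atLeast) auto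
  then show ?thesis by simp
qed

lemma emeasure_pareto_atLeast:
  assumes "0 < p" "1 \<le> t"
  shows "emeasure (pareto p) {t..} = ennreal (t powr - p)"
proof -
  have "emeasure (pareto p) {t..}
      = (\<integral>\<^sup>+x. ennreal (p * x powr (- p - 1)) * indicator {1..} x * indicator {t..} x \<partial>lborel)"
    by (simp add: pareto_def emeasure_density)
  also have "\<dots> = (\<integral>\<^sup>+x. ennreal (p * x powr (- p - 1)) * indicator {t..} x \<partial>lborel)"
    using assms by (intro nn_integral_cong) (auto simp: indicator_def)
  finally show ?thesis using assms by (simp add: nn_integral_powr_atLeast)
qed

lemma emeasure_pareto_atLeastAtMost:
  assumes "0 < p" "1 \<le> t"
  shows "emeasure (pareto p) {1..t} = ennreal (1 - t powr - p)"
proof -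
  have "emeasure (pareto p) {1..t}
      = (\<integral>\<^sup>+x. ennreal (p * x powr (- p - 1)) * indicator {1..} x * indicator {1..t} x \<partial>lborel)"
    by (simp add: pareto_def emeasure_density)
  also have "\<dots> = (\<integral>\<^sup>+x. ennreal (p * x powr (- p - 1)) * indicator {1..t} x \<partial>lborel)"
    by (intro nn_integral_cong) (auto simp: indicator_def)
  also have "\<dots> = ennreal (- (t powr - p) - - (1 powr - p))"
    using assms by (intro nn_integral_FTC_Icc) (auto intro!: derivative_eq_intros)
  finally show ?thesis by simp
qed

lemma real_distribution_pareto:
  assumes "0 < p"
  shows "real_distribution (pareto p)"
proof -
  have "emeasure (pareto p) UNIV = emeasure (pareto p) {1..}"
    by (auto simp: pareto_def emeasure_density indicator_def intro!: nn_integral_cong)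
  then have "prob_space (pareto p)"
    using assms by (intro prob_spaceI) (simp add: emeasure_pareto_atLeast)
  then show ?thesis by (simp add: real_distribution_def real_distribution_axioms_def)
qed

text \<open>Multiplying the density by \<open>x powr r\<close> gives \<open>p / (p - r)\<close>
  times the Pareto density of exponent \<open>p - r\<close>.\<close>

lemma pareto_moment_finite:
  assumes "0 < p" "r < p"
  shows "(\<integral>\<^sup>+x. ennreal (\<bar>x\<bar> powr r) \<partial>pareto p) < \<infinity>"
proof -
  have "(\<integral>\<^sup>+x. ennreal (\<bar>x\<bar> powr r) \<partial>pareto p)
      = (\<integral>\<^sup>+x. ennreal (p / (p - r)) * (ennreal ((p - r) * x powr (- (p - r) - 1)) * indicator {1..} x) \<partial>lborel)"
    using assms
    by (subst nn_integral_pareto)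
      (auto intro!: nn_integral_cong simp: indicator_def ennreal_mult'[symmetric] powr_add[symmetric] mult.assoc diff_add_eq
        split: split_indicator)
  also have "\<dots> = ennreal (p / (p - r)) * ennreal (1 powr - (p - r))"
    using assms nn_integral_powr_atLeast[of 1 "p - r"] by (subst nn_integral_cmult) auto
  finally show ?thesis by simp
qed

text \<open>At the critical exponent the integrand is \<open>p / x\<close>, whose integral diverges
  logarithmically.\<close>

lemma pareto_moment_infinite:
  assumes "0 < p"
  shows "(\<integral>\<^sup>+x. ennreal (\<bar>x\<bar> powr p) \<partial>pareto p) = \<infinity>"
proof -
  have "of_nat k \<le> (\<integral>\<^sup>+x. ennreal (\<bar>x\<bar> powr p) \<partial>pareto p)" for k
  proof -
    \<comment> \<open>Chosen so that the integral of \<open>p / x\<close> over \<open>{1..b}\<close>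
      is exactly \<open>k\<close>.\<close>
    define b where "b = exp (real k / p)"
    have b: "1 \<le> b" using assms by (simp add: b_def)
    have "(of_nat k :: ennreal) = ennreal (p * ln b - p * ln 1)"
      using assms by (simp add: b_def ennreal_of_nat_eq_real_of_nat)
    also have "\<dots> = (\<integral>\<^sup>+x. ennreal (p / x) * indicator {1..b} x \<partial>lborel)"
      using assms b by (intro nn_integral_FTC_Icc[symmetric]) (auto intro!: derivative_eq_intros)
    also have "\<dots> \<le> (\<integral>\<^sup>+x. ennreal (p * x powr (- p - 1)) * indicator {1..} x * ennreal (\<bar>x\<bar> powr p) \<partial>lborel)"
      using assms
      by (intro nn_integral_mono)
        (auto simp: ennreal_mult'[symmetric] powr_add[symmetric] mult.assoc powr_minus_divide split: split_indicator)
    finally show ?thesis by (subst nn_integral_pareto) auto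
  qed
  then show ?thesis
    by (metis ennreal_Ex_less_of_nat infinity_ennreal_def less_top linorder_not_less)
qed

section \<open>The lower bound\<close>

text \<open>For almost every fixed \<open>y\<close>, the gap between the two samples and the
  triangle inequality bound the sum of their errors below, whatever constant \<open>D\<close> is
  compared with. The one-jump bound then applies in \<open>x\<close>, and integrating over
  \<open>y\<close> preserves it.\<close>

lemma expected_GW22_error_ge:
  assumes n: "n \<ge> 2" and \<mu>: "real_distribution \<mu>" and \<nu>: "real_distribution \<nu>"
    and supp: "AE y in \<nu>. y \<in> {-1..1}" and T: "T \<ge> 8"
    and mass: "of_nat n * emeasure \<mu> {T..} \<le> 1"
  shows "ennreal (T^4 / (16 * real n)) * (of_nat n * emeasure \<mu> {T..}) * emeasure \<mu> {1..T/4} ^ n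
    \<le> expected_GW22_error n \<mu> \<nu>"
proof -
  interpret \<mu>: real_distribution \<mu> by (rule \<mu>)
  interpret \<nu>: real_distribution \<nu> by (rule \<nu>)
  interpret M: product_prob_space "\<lambda>_. \<mu>" "{1..n}" by unfold_locales
  interpret N: product_prob_space "\<lambda>_. \<nu>" "{1..n}" by unfold_locales
  interpret pair_prob_space "\<Pi>\<^sub>M i\<in>{1..n}. \<mu>" "\<Pi>\<^sub>M i\<in>{1..n}. \<nu>" by unfold_locales
  let ?M = "\<Pi>\<^sub>M i\<in>{1..n}. \<mu>" and ?N = "\<Pi>\<^sub>M j\<in>{1..n}. \<nu>"
  let ?\<Delta> = "T^4 / (16 * real n)"
  let ?C = "ennreal ?\<Delta> * (of_nat n * emeasure \<mu> {T..}) * emeasure \<mu> {1..T/4} ^ n"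
  define F where "F z = ennreal \<bar>GW22_sq (empirical_measure n (fst z)) (empirical_measure n (snd z)) - GW22_sq \<mu> \<nu>\<bar>" for z
  have F[measurable]: "F \<in> borel_measurable (?M \<Otimes>\<^sub>M ?N)"
    using borel_measurable_GW22_sq_empirical[of n \<mu> \<nu>] n unfolding F_def two_sample_law_def
    by simp
  have bound: "?C \<le> (\<integral>\<^sup>+x. F (x, y) \<partial>?M)"
    if y: "y \<in> space ?N" "\<forall>j\<in>{1..n}. y j \<in> {-1..1}" for y
  proof -
    have "ennreal ?\<Delta> * (of_nat (card {1..n}) * emeasure \<mu> {T..}) * emeasure \<mu> {1..T/4} ^ card {1..n}
      \<le> (\<integral>\<^sup>+x. F (x, y) \<partial>?M)"
    proof (rule nn_integral_PiM_one_jump)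
      show "{1..T/4} \<inter> {T..} = {}" using T by auto
      show "(\<lambda>x. F (x, y)) \<in> borel_measurable ?M" using y(1) by measurable
      fix i x u v
      assume "i \<in> {1..n}" "x \<in> (\<Pi>\<^sub>E j\<in>{1..n} - {i}. {1..T/4})" "u \<in> {1..T/4}" "v \<in> {T..}"
      then have "GW22_sq (empirical_measure n (x(i := u))) (empirical_measure n y) + ?\<Delta>
          \<le> GW22_sq (empirical_measure n (x(i := v))) (empirical_measure n y)"
        using n T y(2) by (intro GW22_sq_empirical_gap) (auto simp: PiE_iff)
      then show "ennreal ?\<Delta> \<le> F (x(i := u), y) + F (x(i := v), y)"
        unfolding F_def by (subst ennreal_plus[symmetric]) (auto intro!: ennreal_leI simp del: ennreal_plus)
    qed (use mass \<mu>.prob_space_axioms in auto)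
    then show ?thesis by simp
  qed
  have AE_y: "AE y in ?N. \<forall>j\<in>{1..n}. y j \<in> {-1..1}"
    using supp by (intro AE_finite_allI N.AE_component) auto
  have "AE y in ?N. ?C \<le> (\<integral>\<^sup>+x. F (x, y) \<partial>?M)"
    using AE_space AE_y by eventually_elim (rule bound)
  then have "(\<integral>\<^sup>+y. ?C \<partial>?N) \<le> (\<integral>\<^sup>+y. \<integral>\<^sup>+x. F (x, y) \<partial>?M \<partial>?N)"
    by (rule nn_integral_mono_AE)
  then have "?C \<le> (\<integral>\<^sup>+y. \<integral>\<^sup>+x. F (x, y) \<partial>?M \<partial>?N)"
    by (simp add: N.P.emeasure_space_1 del: One_nat_def)
  \<comment> \<open>By Tonelli; \<open>F\<close> is measurable on the product.\<close>
  also have "\<dots> = (\<integral>\<^sup>+z. F z \<partial>(?M \<Otimes>\<^sub>M ?N))"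
    by (rule nn_integral_snd[OF F])
  also have "\<dots> = expected_GW22_error n \<mu> \<nu>"
    by (simp add: expected_GW22_error_def two_sample_law_def F_def case_prod_beta')
  finally show ?thesis .
qed

theorem proposition3p2:
  fixes \<nu> :: "real measure" and \<alpha> :: real
  assumes "real_distribution \<nu>"
    and "AE y in \<nu>. y \<in> {-1..1}"
    and "1 < \<alpha>" and "\<alpha> < 2"
  shows "\<exists>\<mu> :: real measure. real_distribution \<mu>
    \<and> (\<integral>\<^sup>+ x. ennreal (\<bar>x\<bar> powr (4 * \<alpha>)) \<partial>\<mu>) = \<infinity>
    \<and> (\<forall>q. 0 < q \<and> q < 2 * \<alpha> \<longrightarrow> (\<integral>\<^sup>+ x. ennreal (\<bar>x\<bar> powr (2 * q)) \<partial>\<mu>) < \<infinity>)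
    \<and> 0 < liminf (\<lambda>n. ennreal (real n powr ((\<alpha> - 1) / \<alpha>)) * expected_GW22_error n \<mu> \<nu>)"
proof -
  define p where "p = 4 * \<alpha>"
  define \<mu> where "\<mu> = pareto p"
  define a :: real where "a = 4 powr p"
  have p: "0 < p" using assms(3) by (simp add: p_def)
  \<comment> \<open>The constant \<open>a\<close> above is the one with
    \<open>(T / 4) powr - p = a / n\<close> for the \<open>T\<close> chosen below.\<close>
  have \<mu>: "real_distribution \<mu>" unfolding \<mu>_def by (rule real_distribution_pareto[OF p])
  \<comment> \<open>This power is the probability that all \<open>n\<close> samples lie in
    \<open>{1..T/4}\<close>; its limit is positive.\<close>
  have "(\<lambda>n. (1 + (- a) / real n) ^ n) \<longlonglongrightarrow> exp (- a)"
    by (rule tendsto_exp_limit_sequentially)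
  then have ev: "eventually (\<lambda>n. exp (- a) / 2 < (1 + (- a) / real n) ^ n) sequentially"
    by (rule order_tendstoD) simp
  have "eventually (\<lambda>n. ennreal (exp (- a) / 32)
      \<le> ennreal (real n powr ((\<alpha> - 1) / \<alpha>)) * expected_GW22_error n \<mu> \<nu>) sequentially"
    using ev eventually_ge_at_top[of 2] eventually_ge_at_top[of "nat \<lceil>8 powr p\<rceil>"]
  proof eventually_elim
    case (elim n)
    \<comment> \<open>Chosen so that the tail beyond \<open>T\<close> has mass exactly
      \<open>1 / n\<close>; then \<open>n \<ge> 8 powr p\<close> means
      \<open>T \<ge> 8\<close>.\<close>
    define T where "T = real n powr (1 / p)"
    have n: "0 < real n" using elim(2) by simp
    have "8 powr p \<le> real n" using elim(3) by linarith
    then have "(8 powr p) powr (1 / p) \<le> T" unfolding T_def using p by (intro powr_mono2) auto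
    then have T: "8 \<le> T" using p by (simp add: powr_powr)
    have Tp: "T powr - p = 1 / real n" using p n by (simp add: T_def powr_powr powr_minus_divide)
    have big: "emeasure \<mu> {T..} = ennreal (1 / real n)"
      unfolding \<mu>_def using emeasure_pareto_atLeast[OF p, of T] T Tp by simp
    have "(T / 4) powr - p = a / real n"
      using T Tp by (simp add: powr_divide a_def powr_minus_divide)
    \<comment> \<open>This gives \<open>1 - a / n \<ge> 0\<close>, without which
      \<open>ennreal\<close> would truncate and not commute with the power.\<close>
    moreover have "(T / 4) powr - p \<le> 1"
      using T p powr_mono2'[of "-p" 1 "T / 4"] by simp
    ultimately have small: "emeasure \<mu> {1..T/4} = ennreal (1 + (- a) / real n)" "0 \<le> 1 + (- a) / real n"
      unfolding \<mu>_def using emeasure_pareto_atLeastAtMost[OF p, of "T / 4"] T by simp_all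
    have one: "of_nat n * emeasure \<mu> {T..} = 1"
      using n by (simp add: big ennreal_of_nat_eq_real_of_nat flip: ennreal_mult)
    \<comment> \<open>Since \<open>4 / p = 1 / \<alpha>\<close>, the normalisation cancels
      \<open>T^4 / n\<close> exactly.\<close>
    have "T^4 = real n powr (1 / \<alpha>)"
      using n assms(3) by (simp add: T_def p_def powr_powr flip: powr_realpow)
    then have "real n powr ((\<alpha> - 1) / \<alpha>) * T^4 = real n powr ((\<alpha> - 1) / \<alpha> + 1 / \<alpha>)"
      by (simp add: powr_add)
    also have "(\<alpha> - 1) / \<alpha> + 1 / \<alpha> = 1"
      using assms(3) by (simp add: field_simps)
    finally have scale: "real n powr ((\<alpha> - 1) / \<alpha>) * (T^4 / (16 * real n)) = 1 / 16"
      using n by simp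
    \<comment> \<open>The factor \<open>1/16\<close> comes from the gap, the other
      \<open>1/2\<close> from the margin left below the limit \<open>exp (- a)\<close>.\<close>
    have "ennreal (exp (- a) / 32) \<le> ennreal (1 / 16 * (1 + (- a) / real n) ^ n)"
      using elim(1) by (intro ennreal_leI) simp
    also have "\<dots> = ennreal (real n powr ((\<alpha> - 1) / \<alpha>)) *
        (ennreal (T^4 / (16 * real n)) * (of_nat n * emeasure \<mu> {T..}) * emeasure \<mu> {1..T/4} ^ n)"
      unfolding one scale[symmetric] small(1) ennreal_power[OF small(2)] using small(2)
      by (simp add: mult.assoc flip: ennreal_mult)
    also have "\<dots> \<le> ennreal (real n powr ((\<alpha> - 1) / \<alpha>)) * expected_GW22_error n \<mu> \<nu>"
      using elim(2) one
      by (intro mult_left_mono expected_GW22_error_ge[OF _ \<mu> assms(1,2) T]) auto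
    finally show ?case .
  qed
  then have "ennreal (exp (- a) / 32)
      \<le> liminf (\<lambda>n. ennreal (real n powr ((\<alpha> - 1) / \<alpha>)) * expected_GW22_error n \<mu> \<nu>)"
    by (rule Liminf_bounded)
  moreover have "0 < ennreal (exp (- a) / 32)" by simp
  ultimately have "0 < liminf (\<lambda>n. ennreal (real n powr ((\<alpha> - 1) / \<alpha>)) * expected_GW22_error n \<mu> \<nu>)"
    by (rule less_le_trans[rotated])
  moreover have "(\<integral>\<^sup>+ x. ennreal (\<bar>x\<bar> powr (4 * \<alpha>)) \<partial>\<mu>) = \<infinity>"
    unfolding \<mu>_def p_def[symmetric] by (rule pareto_moment_infinite[OF p])
  moreover have "(\<integral>\<^sup>+ x. ennreal (\<bar>x\<bar> powr (2 * q)) \<partial>\<mu>) < \<infinity>" if "q < 2 * \<alpha>" for q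
    unfolding \<mu>_def using that by (intro pareto_moment_finite[OF p]) (simp add: p_def)
  ultimately show ?thesis using \<mu> by blast
qed

end
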